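(* Let $\mathbb{K}$ be a field of characteristic zero and let $q\in\mathbb{K}\setminus\{0\}$ be not a root of unity. For $f,g\in\mathbb{K}[x_1,\ldots,x_n]$ define the $q$-dispersion set \[ qDisp(f,g)=\{(\ell,\ell_1,\ldots,\ell_n)\in\mathbb{Z}^{n+1}\ :\ f=q^{\ell}\tau_{x_1}^{\ell_1}\cdots\tau_{x_n}^{\ell_n}(g)\}, \] where $\tau_{x_i}$ is the $q$-shift operator $\tau_{x_i}h(x_1,\ldots,x_n)=h(x_1,\ldots,x_{i-1},qx_i,x_{i+1},\ldots,x_n)$. Then, given any two polynomials $f,g\in\mathbb{K}[x_1,\ldots,x_n]$, the set $qDisp(f,g)$ can be determined (computed). In particular, one can decide whether $f$ and $g$ are $q$-shift equivalent, i.e. whether $f=q^{\ell}\tau_{x_1}^{\ell_1}\cdots\tau_{x_n}^{\ell_n}(g)$ for some integers $\ell,\ell_1,\dots,\ell_n$ (equivalently whether $qDisp(f,g)\neq\emptyset$).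
   Context: The $q$-shift operators $\tau_{x_i}$ are automorphisms of $\mathbb{K}[x_1,\dots,x_n]$ (and of its fraction field) acting by $x_i\mapsto qx_i$ and fixing the other variables and $\mathbb{K}$.
   Formalization: The algorithm may use field operations, equality tests and a test whether an element of K is an integer power of q; the English names no such ability, but the claim fails without it, since deciding whether a constant c is q-shift equivalent to 1 is exactly this test. *)

theory Defs
  imports Complex_Main "HOL-Library.Poly_Mapping"
begin

section \<open>Polynomials and \<open>q\<close>-shifts\<close>

text \<open>A polynomial is a finitely supported map from exponent vectors to coefficients. The ring
  \<open>K[x_1,...,x_n]\<close> is \<open>polys n\<close>, with \<open>x_(i+1)\<close> being \<open>Var i\<close>.\<close>

type_synonym 'a mpoly = "(nat \<Rightarrow>\<^sub>0 nat) \<Rightarrow>\<^sub>0 'a"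

definition polys :: "nat \<Rightarrow> 'a::zero mpoly set" where
  "polys n = {p. \<forall>m \<in> Poly_Mapping.keys p. Poly_Mapping.keys m \<subseteq> {..<n}}"

definition Const :: "'a::zero \<Rightarrow> 'a mpoly" where
  "Const c = Poly_Mapping.single 0 c"

definition Var :: "nat \<Rightarrow> 'a::zero_neq_one mpoly" where
  "Var i = Poly_Mapping.single (Poly_Mapping.single i 1) 1"

definition psubst :: "(nat \<Rightarrow> 'a::comm_ring_1 mpoly) \<Rightarrow> 'a mpoly \<Rightarrow> 'a mpoly" where
  "psubst \<sigma> p = (\<Sum>m \<in> Poly_Mapping.keys p. Const (Poly_Mapping.lookup p m) *
     (\<Prod>j \<in> Poly_Mapping.keys m. \<sigma> j ^ Poly_Mapping.lookup m j))"

definition tau :: "'a::field \<Rightarrow> nat \<Rightarrow> 'a mpoly \<Rightarrow> 'a mpoly" where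
  "tau q i = psubst (\<lambda>j. if j = i then Const q * Var i else Var j)"

definition tau_pow :: "'a::field \<Rightarrow> nat \<Rightarrow> int \<Rightarrow> 'a mpoly \<Rightarrow> 'a mpoly" where
  "tau_pow q i l = (if l \<ge> 0 then tau q i ^^ nat l else inv (tau q i) ^^ nat (- l))"

definition tau_prod :: "'a::field \<Rightarrow> nat \<Rightarrow> int list \<Rightarrow> 'a mpoly \<Rightarrow> 'a mpoly" where
  "tau_prod q n ls = foldr (\<lambda>i. tau_pow q i (ls ! i)) [0..<n]"

text \<open>Elements of \<open>\<int>\<^sup>n\<^sup>+\<^sup>1\<close> are integer lists of length \<open>n + 1\<close>.\<close>

definition qDisp :: "nat \<Rightarrow> 'a::field \<Rightarrow> 'a mpoly \<Rightarrow> 'a mpoly \<Rightarrow> int list set" where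
  "qDisp n q f g = {l # ls | l ls. length ls = n \<and> f = Const (q powi l) * tau_prod q n ls g}"

definition q_shift_equivalent :: "nat \<Rightarrow> 'a::field \<Rightarrow> 'a mpoly \<Rightarrow> 'a mpoly \<Rightarrow> bool" where
  "q_shift_equivalent n q f g \<longleftrightarrow>
     (\<exists>(l::int) ls. length ls = n \<and> f = Const (q powi l) * tau_prod q n ls g)"


section \<open>Algorithms over a field\<close>

text \<open>Computability over an arbitrary, possibly uncountable, field \<open>K\<close> is rendered by finite
  programs that handle elements of \<open>K\<close> only through the field operations, equality tests, the
  constant \<open>q\<close> and the test whether an element is an integer power of \<open>q\<close>. All other data are
  integers and pairs, and unbounded loops are available.

  The power test is the usual requirement that the constant field be \<open>q\<close>-suitable. It cannot be
  dropped: a nonzero constant \<open>c\<close> is \<open>q\<close>-shift equivalent to \<open>1\<close> iff it is an integer power of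
  \<open>q\<close>, and there are fields with computable arithmetic and equality in which this is undecidable.
  The test yields one bit; the exponent has to be found by the program.\<close>

datatype 'a val = VNull | VInt int | VElem 'a | VPair "'a val" "'a val"

datatype prim =
    LitNull | LitInt int | LitQ
  | Fst | Snd | IsPair
  | IntAdd | IntSub | IntMul | IntLe
  | FieldAdd | FieldSub | FieldMul | FieldDiv | FieldEq | FieldIsPowerOfQ

definition VBool :: "bool \<Rightarrow> 'a val" where
  "VBool b = VInt (if b then 1 else 0)"

text \<open>\<open>None\<close>: the operation is not applicable and the computation is stuck.\<close>

fun apply_prim :: "'a::field \<Rightarrow> prim \<Rightarrow> 'a val \<Rightarrow> 'a val option" where
  "apply_prim q LitNull v = Some VNull"
| "apply_prim q (LitInt k) v = Some (VInt k)"
| "apply_prim q LitQ v = Some (VElem q)"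
| "apply_prim q Fst (VPair u v) = Some u"
| "apply_prim q Snd (VPair u v) = Some v"
| "apply_prim q IsPair (VPair u v) = Some (VBool True)"
| "apply_prim q IsPair v = Some (VBool False)"
| "apply_prim q IntAdd (VPair (VInt a) (VInt b)) = Some (VInt (a + b))"
| "apply_prim q IntSub (VPair (VInt a) (VInt b)) = Some (VInt (a - b))"
| "apply_prim q IntMul (VPair (VInt a) (VInt b)) = Some (VInt (a * b))"
| "apply_prim q IntLe (VPair (VInt a) (VInt b)) = Some (VBool (a \<le> b))"
| "apply_prim q FieldAdd (VPair (VElem a) (VElem b)) = Some (VElem (a + b))"
| "apply_prim q FieldSub (VPair (VElem a) (VElem b)) = Some (VElem (a - b))"
| "apply_prim q FieldMul (VPair (VElem a) (VElem b)) = Some (VElem (a * b))"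
| "apply_prim q FieldDiv (VPair (VElem a) (VElem b)) =
     (if b = 0 then None else Some (VElem (a / b)))"
| "apply_prim q FieldEq (VPair (VElem a) (VElem b)) = Some (VBool (a = b))"
| "apply_prim q FieldIsPowerOfQ (VElem a) = Some (VBool (\<exists>k::int. a = q powi k))"
| "apply_prim q _ _ = None"

datatype prog =
    Skip
  | Prim prim
  | Seq prog prog
  | Fork prog prog
  | Cond prog prog prog
  | Loop prog prog

text \<open>\<open>run q P v w\<close>: program \<open>P\<close>, started on \<open>v\<close>, halts with result \<open>w\<close>.\<close>

inductive run :: "'a::field \<Rightarrow> prog \<Rightarrow> 'a val \<Rightarrow> 'a val \<Rightarrow> bool" for q where
  run_Skip: "run q Skip v v"
| run_Prim: "apply_prim q c v = Some w \<Longrightarrow> run q (Prim c) v w"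
| run_Seq: "run q P v u \<Longrightarrow> run q R u w \<Longrightarrow> run q (Seq P R) v w"
| run_Fork: "run q P v u \<Longrightarrow> run q R v w \<Longrightarrow> run q (Fork P R) v (VPair u w)"
| run_CondT: "run q B v (VInt k) \<Longrightarrow> k \<noteq> 0 \<Longrightarrow> run q P v w \<Longrightarrow> run q (Cond B P R) v w"
| run_CondF: "run q B v (VInt 0) \<Longrightarrow> run q R v w \<Longrightarrow> run q (Cond B P R) v w"
| run_LoopT: "run q B v (VInt k) \<Longrightarrow> k \<noteq> 0 \<Longrightarrow> run q P v u \<Longrightarrow> run q (Loop B P) u w \<Longrightarrow>
    run q (Loop B P) v w"
| run_LoopF: "run q B v (VInt 0) \<Longrightarrow> run q (Loop B P) v v"

inductive_cases run_SkipE: "run q Skip v w"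
inductive_cases run_PrimE: "run q (Prim c) v w"
inductive_cases run_SeqE: "run q (Seq P R) v w"
inductive_cases run_ForkE: "run q (Fork P R) v w"
inductive_cases run_CondE: "run q (Cond B P R) v w"
inductive_cases run_LoopE: "run q (Loop B P) v w"

lemma run_deterministic: "run q P v w \<Longrightarrow> run q P v w' \<Longrightarrow> w = w'"
proof (induction arbitrary: w' rule: run.induct)
  case (run_Skip v)
  then show ?case by (auto elim: run_SkipE)
next
  case (run_Prim c v w)
  then show ?case by (auto elim: run_PrimE)
next
  case (run_Seq P v u R w)
  from run_Seq.prems show ?case by (rule run_SeqE) (use run_Seq.IH in blast)
next
  case (run_Fork P v u R w)
  from run_Fork.prems show ?case by (rule run_ForkE) (use run_Fork.IH in blast)
next
  case (run_CondT B v k P w R)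
  from run_CondT.prems show ?case by (rule run_CondE) (use run_CondT.IH run_CondT.hyps in blast)+
next
  case (run_CondF B v R w P)
  from run_CondF.prems show ?case by (rule run_CondE) (use run_CondF.IH in blast)+
next
  case (run_LoopT B v k P u w)
  from run_LoopT.prems show ?case by (rule run_LoopE) (use run_LoopT.IH run_LoopT.hyps in blast)+
next
  case (run_LoopF B v P)
  from run_LoopF.prems show ?case by (rule run_LoopE) (use run_LoopF.IH in blast)+
qed


section \<open>Encoding of input and output\<close>

fun enc_list :: "'a val list \<Rightarrow> 'a val" where
  "enc_list [] = VNull"
| "enc_list (v # vs) = VPair v (enc_list vs)"

definition enc_ints :: "int list \<Rightarrow> 'a val" where
  "enc_ints ks = enc_list (map VInt ks)"

definition enc_terms :: "(nat list \<times> 'a) list \<Rightarrow> 'a val" where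
  "enc_terms ts = enc_list (map (\<lambda>(\<alpha>, c). VPair (enc_ints (map int \<alpha>)) (VElem c)) ts)"

text \<open>\<open>ts\<close> lists the nonzero terms of \<open>p\<close>, in any order.\<close>

definition term_list :: "nat \<Rightarrow> 'a::zero mpoly \<Rightarrow> (nat list \<times> 'a) list \<Rightarrow> bool" where
  "term_list n p ts \<longleftrightarrow> distinct ts \<and>
     set ts = (\<lambda>m. (map (Poly_Mapping.lookup m) [0..<n], Poly_Mapping.lookup p m)) `
                Poly_Mapping.keys p"

definition enc_input :: "nat \<Rightarrow> (nat list \<times> 'a) list \<Rightarrow> (nat list \<times> 'a) list \<Rightarrow> 'a val" where
  "enc_input n fs gs = VPair (VInt (int n)) (VPair (enc_terms fs) (enc_terms gs))"

text \<open>A subset of \<open>\<int>\<^sup>N\<close> is output either as the empty set or as a coset of a subgroup, given by one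
  element \<open>v\<close> and generators \<open>bs\<close> of the subgroup.\<close>

type_synonym coset_desc = "(int list \<times> int list list) option"

fun wf_desc :: "nat \<Rightarrow> coset_desc \<Rightarrow> bool" where
  "wf_desc N None \<longleftrightarrow> True"
| "wf_desc N (Some (v, bs)) \<longleftrightarrow> length v = N \<and> (\<forall>b \<in> set bs. length b = N)"

fun desc_set :: "coset_desc \<Rightarrow> int list set" where
  "desc_set None = {}"
| "desc_set (Some (v, bs)) =
     {map (\<lambda>j. v ! j + (\<Sum>k<length bs. z k * (bs ! k) ! j)) [0..<length v] | z :: nat \<Rightarrow> int. True}"

fun enc_desc :: "coset_desc \<Rightarrow> 'a val" where
  "enc_desc None = VNull"
| "enc_desc (Some (v, bs)) = VPair (enc_ints v) (enc_list (map enc_ints bs))"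

definition computes_qDisp :: "'a::field \<Rightarrow> prog \<Rightarrow> bool" where
  "computes_qDisp q P \<longleftrightarrow>
     (\<forall>n. \<forall>f \<in> polys n. \<forall>g \<in> polys n. \<forall>fs gs. term_list n f fs \<longrightarrow> term_list n g gs \<longrightarrow>
        (\<exists>D. run q P (enc_input n fs gs) (enc_desc D) \<and> wf_desc (n + 1) D \<and>
             desc_set D = qDisp n q f g))"

definition decides_q_shift_equivalence :: "'a::field \<Rightarrow> prog \<Rightarrow> bool" where
  "decides_q_shift_equivalence q P \<longleftrightarrow>
     (\<forall>n. \<forall>f \<in> polys n. \<forall>g \<in> polys n. \<forall>fs gs. term_list n f fs \<longrightarrow> term_list n g gs \<longrightarrow>
        run q P (enc_input n fs gs) (VBool (q_shift_equivalent n q f g)))"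

end

theory Submission
  imports Defs "HOL-Library.Function_Algebras"
begin

text \<open>Comparing coefficients, \<open>f = q\<^sup>l \<tau>\<^sub>1\<^bsup>l\<^sub>1\<^esup> ... \<tau>\<^sub>n\<^bsup>l\<^sub>n\<^esup> g\<close> holds iff for every exponent vector
  \<open>\<alpha>\<close> in the support of \<open>f\<close> or \<open>g\<close> the coefficients satisfy \<open>f\<^sub>\<alpha> = q\<^bsup>l + l\<^sub>1 \<alpha>\<^sub>1 + ... + l\<^sub>n \<alpha>\<^sub>n\<^esup> g\<^sub>\<alpha>\<close>.
  If \<open>f\<^sub>\<alpha> / g\<^sub>\<alpha> = q\<^sup>k\<close>, where \<open>k\<close> is unique and found by search, this is the linear equation
  \<open>- k t + l + l\<^sub>1 \<alpha>\<^sub>1 + ... + l\<^sub>n \<alpha>\<^sub>n = 0\<close> at \<open>t = 1\<close>; otherwise it is unsolvable, which is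
  expressed by the equation \<open>t = 0\<close>. Starting from \<open>\<int>\<^bsup>n + 2\<^esup>\<close>, the lattice of solutions \<open>(t, l, l\<^sub>1, ..., l\<^sub>n)\<close>
  is cut down by one equation after the other: the Euclidean algorithm on the values of the equation
  at the generators leaves at most one generator with nonzero value, and that one is dropped.
  A last Euclidean pass, on the coordinate \<open>t\<close>, leaves one generator with \<open>t \<noteq> 0\<close>, and the solutions
  with \<open>t = 1\<close> exist iff its \<open>t\<close> is \<open>1\<close> or \<open>- 1\<close>.\<close>

section \<open>Evaluation of programs\<close>

text \<open>The partial function computed by a program, single-valued by
  \<open>run_deterministic\<close>. It turns statements about halting runs into equations for
  rewriting.\<close>

definition sem :: "'a::field \<Rightarrow> prog \<Rightarrow> 'a val \<Rightarrow> 'a val option" where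
  "sem q P v = (if \<exists>w. run q P v w then Some (THE w. run q P v w) else None)"

lemma sem_eq_Some_iff: "sem q P v = Some w \<longleftrightarrow> run q P v w"
proof -
  have "(THE w'. run q P v w') = w" if "run q P v w" for w
    using that run_deterministic by (intro the_equality) blast+
  then show ?thesis by (auto simp: sem_def)
qed

lemma sem_eqI: "(\<And>w. run q P v w \<longleftrightarrow> x = Some w) \<Longrightarrow> sem q P v = x"
  by (metis sem_eq_Some_iff not_None_eq)

lemma sem_Skip [simp]: "sem q Skip v = Some v"
  by (rule sem_eqI) (auto intro: run.intros elim: run_SkipE)

lemma sem_Prim [simp]: "sem q (Prim c) v = apply_prim q c v"
  by (rule sem_eqI) (auto intro: run.intros elim: run_PrimE)

lemma sem_Seq [simp]: "sem q (Seq P R) v = Option.bind (sem q P v) (sem q R)"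
  by (rule sem_eqI) (auto intro: run.intros elim!: run_SeqE simp: bind_eq_Some_conv sem_eq_Some_iff)

lemma sem_Fork [simp]:
  "sem q (Fork P R) v = Option.bind (sem q P v) (\<lambda>u. map_option (VPair u) (sem q R v))"
  by (rule sem_eqI) (auto intro: run.intros elim!: run_ForkE simp: bind_eq_Some_conv sem_eq_Some_iff)

lemma sem_Cond [simp]:
  "sem q B v = Some (VInt k) \<Longrightarrow> sem q (Cond B P R) v = (if k = 0 then sem q R v else sem q P v)"
  by (rule sem_eqI) (auto simp: sem_eq_Some_iff intro: run.intros
      elim!: run_CondE dest: run_deterministic)

text \<open>Unfolds one iteration. The equation also covers divergence, where both sides are
  \<open>None\<close>; termination has to come from an induction around it.\<close>

lemma sem_Loop:
  assumes "sem q B v = Some (VInt k)"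
  shows "sem q (Loop B P) v = (if k = 0 then Some v else Option.bind (sem q P v) (sem q (Loop B P)))"
proof (rule sem_eqI)
  fix w
  have B: "run q B v (VInt k') \<longleftrightarrow> k' = k" for k'
    using assms by (auto simp: sem_eq_Some_iff dest: run_deterministic)
  have "run q (Loop B P) v w \<longleftrightarrow>
      (if k = 0 then w = v else \<exists>u. run q P v u \<and> run q (Loop B P) u w)"
    by (auto elim: run_LoopE simp: B intro: run_LoopT[of q B v k] run_LoopF)
  then show "run q (Loop B P) v w \<longleftrightarrow>
      (if k = 0 then Some v else Option.bind (sem q P v) (sem q (Loop B P))) = Some w"
    by (auto simp: bind_eq_Some_conv sem_eq_Some_iff)
qed

declare VBool_def [simp]

section \<open>Programs on lists\<close>

text \<open>Programs take their arguments as right-nested pairs; \<open>rest k\<close> drops the first \<open>k\<close> of them.\<close>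

abbreviation "arg0 \<equiv> Prim Fst"
abbreviation "rest1 \<equiv> Prim Snd"
abbreviation "arg1 \<equiv> Seq rest1 arg0"
abbreviation "rest2 \<equiv> Seq rest1 rest1"
abbreviation "arg2 \<equiv> Seq rest2 arg0"
abbreviation "rest3 \<equiv> Seq rest2 rest1"
abbreviation "arg3 \<equiv> Seq rest3 arg0"
abbreviation "rest4 \<equiv> Seq rest3 rest1"
abbreviation "arg4 \<equiv> Seq rest4 arg0"
abbreviation "rest5 \<equiv> Seq rest4 rest1"
abbreviation "lit k \<equiv> Prim (LitInt k)"
abbreviation "nul \<equiv> Prim LitNull"
abbreviation "op2 c P R \<equiv> Seq (Fork P R) (Prim c)"
abbreviation "sqr P \<equiv> Seq P (op2 IntMul Skip Skip)"
abbreviation "eq0 P \<equiv> op2 IntLe (sqr P) (lit 0)"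

lemma sq_le_0_iff [simp]: "(x::int) * x \<le> 0 \<longleftrightarrow> x = 0"
  by (metis mult_eq_0_iff order_antisym zero_le_square order_refl)

definition Fold :: "prog \<Rightarrow> prog" where
  "Fold P = Seq (Loop (Seq arg0 (Prim IsPair))
     (Fork (Seq arg0 rest1) (Fork (Seq (Fork (Seq arg0 arg0) rest1) P) rest2))) arg1"

lemma sem_Fold_Nil: "sem q (Fold P) (VPair VNull (VPair a e)) = Some a"
  by (simp add: Fold_def sem_Loop)

lemma sem_Fold_Cons:
  "sem q (Fold P) (VPair (VPair x xs) (VPair a e)) =
     Option.bind (sem q P (VPair x (VPair a e))) (\<lambda>a'. sem q (Fold P) (VPair xs (VPair a' e)))"
  by (cases "sem q P (VPair x (VPair a e))") (simp_all add: Fold_def sem_Loop)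

text \<open>An invariant rule for bodies whose result is known only up to a property, as for the
  Euclidean algorithm below; \<open>sem_Fold\<close> treats bodies that compute a given
  function.\<close>

lemma sem_Fold_rel:
  assumes "I xs a"
    and "\<And>x xs a. I (x # xs) a \<Longrightarrow> \<exists>a'. sem q P (VPair x (VPair a e)) = Some a' \<and> I xs a'"
  shows "\<exists>a'. sem q (Fold P) (VPair (enc_list xs) (VPair a e)) = Some a' \<and> I [] a'"
  using assms(1)
proof (induction xs arbitrary: a)
  case Nil
  then show ?case by (simp add: sem_Fold_Nil)
next
  case (Cons x xs)
  from assms(2)[OF Cons.prems] obtain a' where
    a': "sem q P (VPair x (VPair a e)) = Some a'" "I xs a'" by blast
  from Cons.IH[OF a'(2)] a'(1) show ?case by (simp add: sem_Fold_Cons)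
qed

lemma sem_Fold:
  assumes "\<And>x a. x \<in> set xs \<Longrightarrow> sem q P (VPair (ex x) (VPair (ea a) e)) = Some (ea (h x a))"
  shows "sem q (Fold P) (VPair (enc_list (map ex xs)) (VPair (ea a) e)) = Some (ea (fold h xs a))"
  using assms
proof (induction xs arbitrary: a)
  case Nil
  then show ?case by (simp add: sem_Fold_Nil)
next
  case (Cons x xs)
  then show ?case by (simp add: sem_Fold_Cons)
qed

lemma fold_Cons_map: "fold (\<lambda>x a. h x # a) xs ys = rev (map h xs) @ ys"
  by (induction xs arbitrary: ys) auto

lemma fold_add_sum: "fold (\<lambda>x a. a + h x) xs s = s + sum_list (map h xs)" for s :: int
  by (induction xs arbitrary: s) auto

text \<open>Pairs are stacked as they are read, hence the reversal. It is harmless for sums, and a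
  fold that conses its results undoes it.\<close>

definition ZipRev :: prog where
  "ZipRev = Seq (Fork arg0 (Fork arg1 nul)) (Seq
     (Loop (Cond (Seq arg0 (Prim IsPair)) (Seq arg1 (Prim IsPair)) (lit 0))
       (Fork (Seq arg0 rest1) (Fork (Seq arg1 rest1)
         (Fork (Fork (Seq arg0 arg0) (Seq arg1 arg0)) rest2))))
     rest2)"

lemma enc_ints_simps [simp]:
  "enc_ints [] = VNull" "enc_ints (x # xs) = VPair (VInt x) (enc_ints xs)"
  by (simp_all add: enc_ints_def)

lemma sem_ZipRev:
  "sem q ZipRev (VPair (enc_ints xs) (VPair (enc_ints ys) e)) =
     Some (enc_list (map (\<lambda>(x, y). VPair (VInt x) (VInt y)) (rev (zip xs ys))))"
proof -
  let ?L = "Seq (Loop (Cond (Seq arg0 (Prim IsPair)) (Seq arg1 (Prim IsPair)) (lit 0))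
       (Fork (Seq arg0 rest1) (Fork (Seq arg1 rest1)
         (Fork (Fork (Seq arg0 arg0) (Seq arg1 arg0)) rest2)))) rest2"
  have "sem q ?L (VPair (enc_ints xs) (VPair (enc_ints ys) (enc_list acc))) =
     Some (enc_list (map (\<lambda>(x, y). VPair (VInt x) (VInt y)) (rev (zip xs ys)) @ acc))" for acc
  proof (induction xs ys arbitrary: acc rule: list_induct2')
    case (4 x xs y ys)
    from 4[of "VPair (VInt x) (VInt y) # acc"] show ?case by (simp add: sem_Loop)
  qed (simp_all add: sem_Loop)
  from this[of "[]"] show ?thesis by (simp add: ZipRev_def)
qed

definition dot :: "int list \<Rightarrow> int list \<Rightarrow> int" where
  "dot xs ys = sum_list (map2 (*) xs ys)"

definition lin :: "int \<Rightarrow> int list \<Rightarrow> int list \<Rightarrow> int list" where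
  "lin s = map2 (\<lambda>x y. s * x + y)"

definition Dot :: prog where
  "Dot = Seq (Fork ZipRev (Fork (lit 0) Skip)) (Fold (op2 IntAdd arg1 (Seq arg0 (Prim IntMul))))"

lemma sem_Dot [simp]:
  "sem q Dot (VPair (enc_ints xs) (VPair (enc_ints ys) e)) = Some (VInt (dot xs ys))"
proof -
  have "sem q (Fold (op2 IntAdd arg1 (Seq arg0 (Prim IntMul))))
      (VPair (enc_list (map (\<lambda>(x, y). VPair (VInt x) (VInt y)) (rev (zip xs ys)))) (VPair (VInt 0) e'))
     = Some (VInt (fold (\<lambda>z a. a + case_prod (*) z) (rev (zip xs ys)) 0))" for e'
    by (rule sem_Fold[where ea = VInt]) auto
  then show ?thesis
    by (simp add: Dot_def sem_ZipRev dot_def fold_add_sum rev_map[symmetric])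
qed

definition Lin :: prog where
  "Lin = Seq (Fork (Seq rest1 ZipRev) (Fork nul arg0))
     (Fold (Fork (op2 IntAdd (op2 IntMul rest2 (Seq arg0 arg0)) (Seq arg0 rest1)) arg1))"

lemma sem_Lin [simp]:
  "sem q Lin (VPair (VInt s) (VPair (enc_ints xs) (VPair (enc_ints ys) e))) =
     Some (enc_ints (lin s xs ys))"
proof -
  have "sem q (Fold (Fork (op2 IntAdd (op2 IntMul rest2 (Seq arg0 arg0)) (Seq arg0 rest1)) arg1))
      (VPair (enc_list (map (\<lambda>(x, y). VPair (VInt x) (VInt y)) (rev (zip xs ys))))
        (VPair (enc_ints []) (VInt s)))
     = Some (enc_ints (fold (\<lambda>z a. (case z of (x, y) \<Rightarrow> s * x + y) # a) (rev (zip xs ys)) []))"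
    by (rule sem_Fold[where ea = enc_ints]) auto
  then show ?thesis
    by (simp add: Lin_def sem_ZipRev lin_def fold_Cons_map rev_map[symmetric])
qed

text \<open>The squared Euclidean distance. No primitive compares lists, so their equality is tested
  by the vanishing of this integer.\<close>

definition list_dist :: "int list \<Rightarrow> int list \<Rightarrow> int" where
  "list_dist xs ys = sum_list (map2 (\<lambda>x y. (x - y) * (x - y)) xs ys)"

lemma list_dist_eq_0_iff: "length xs = length ys \<Longrightarrow> list_dist xs ys = 0 \<longleftrightarrow> xs = ys"
proof (induction xs ys rule: list_induct2)
  case (Cons x xs y ys)
  have "0 \<le> list_dist xs ys"
    unfolding list_dist_def by (rule sum_list_nonneg) auto
  with Cons show ?case
    by (auto simp: list_dist_def add_nonneg_eq_0_iff)
qed (simp add: list_dist_def)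

definition Dist :: prog where
  "Dist = Seq (Fork ZipRev (Fork (lit 0) Skip))
     (Fold (op2 IntAdd arg1 (sqr (Seq arg0 (Prim IntSub)))))"

lemma sem_Dist [simp]:
  "sem q Dist (VPair (enc_ints xs) (VPair (enc_ints ys) e)) = Some (VInt (list_dist xs ys))"
proof -
  have "sem q (Fold (op2 IntAdd arg1 (sqr (Seq arg0 (Prim IntSub)))))
      (VPair (enc_list (map (\<lambda>(x, y). VPair (VInt x) (VInt y)) (rev (zip xs ys)))) (VPair (VInt 0) e'))
     = Some (VInt (fold (\<lambda>z a. a + (case z of (x, y) \<Rightarrow> (x - y) * (x - y))) (rev (zip xs ys)) 0))" for e'
    by (rule sem_Fold[where ea = VInt]) auto
  then show ?thesis
    by (simp add: Dist_def sem_ZipRev list_dist_def fold_add_sum rev_map[symmetric])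
qed

section \<open>The linear equation attached to a monomial\<close>

text \<open>The only field constant available to programs is \<open>q\<close>, so 0 is obtained as
  \<open>q - q\<close> and, below, 1 as \<open>q / q\<close>.\<close>

definition Zero_elem :: prog where
  "Zero_elem = op2 FieldSub (Prim LitQ) (Prim LitQ)"

lemma sem_Zero_elem [simp]: "sem q Zero_elem v = Some (VElem 0)"
  by (simp add: Zero_elem_def)

definition One_elem :: prog where
  "One_elem = op2 FieldDiv (Prim LitQ) (Prim LitQ)"

lemma sem_One_elem [simp]: "q \<noteq> 0 \<Longrightarrow> sem q One_elem v = Some (VElem 1)"
  by (simp add: One_elem_def)

definition Lookup :: prog where
  "Lookup = Seq (Fork arg1 (Fork Zero_elem arg0))
     (Fold (Cond (eq0 (Seq (Fork rest2 (Fork (Seq arg0 arg0) Skip)) Dist)) (Seq arg0 rest1) arg1))"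

text \<open>The initial 0 is the coefficient of a monomial that is not listed.\<close>

definition lookup_terms :: "nat list \<Rightarrow> (nat list \<times> 'a::zero) list \<Rightarrow> 'a" where
  "lookup_terms \<alpha> ts = fold (\<lambda>(\<beta>, d) a. if \<alpha> = \<beta> then d else a) ts 0"

lemma sem_Lookup [simp]:
  assumes "\<And>\<beta>. \<beta> \<in> fst ` set ts \<Longrightarrow> length \<beta> = length \<alpha>"
  shows "sem q Lookup (VPair (enc_ints (map int \<alpha>)) (VPair (enc_terms ts) e)) =
    Some (VElem (lookup_terms \<alpha> ts))"
proof -
  have *: "list_dist (map int \<alpha>) (map int \<beta>) = 0 \<longleftrightarrow> \<alpha> = \<beta>" if "(\<beta>, d) \<in> set ts" for \<beta> d
    using assms that by (force simp: list_dist_eq_0_iff)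
  show ?thesis
    unfolding Lookup_def lookup_terms_def enc_terms_def
    by (simp, rule sem_Fold[where ea = VElem]) (auto simp: *)
qed

text \<open>The state of the search for the exponent of \<open>c\<close> is \<open>(q\<^sup>j, 1 / q\<^sup>j, j, c)\<close>.\<close>

definition Power_search :: prog where
  "Power_search = Seq (Fork One_elem (Fork One_elem (Fork (lit 0) Skip))) (Seq
     (Loop (Cond (op2 FieldEq arg0 rest3) (lit 0) (Cond (op2 FieldEq arg1 rest3) (lit 0) (lit 1)))
       (Fork (op2 FieldMul arg0 (Prim LitQ)) (Fork (op2 FieldDiv arg1 (Prim LitQ))
         (Fork (op2 IntAdd arg2 (lit 1)) rest3))))
     (Cond (op2 FieldEq arg0 rest3) arg2 (op2 IntSub (lit 0) arg2)))"

text \<open>Inner products ignore the missing entries of the shorter list, so \<open>[1]\<close> is the equation \<open>t = 0\<close>.\<close>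

definition row :: "'a::field \<Rightarrow> nat list \<Rightarrow> 'a \<Rightarrow> 'a \<Rightarrow> int list" where
  "row q \<alpha> c d = (if d \<noteq> 0 \<and> (\<exists>k::int. c / d = q powi k)
     then - (THE k. c / d = q powi k) # 1 # map int \<alpha> else [1])"

definition Unsolvable :: prog where
  "Unsolvable = Fork (lit 1) nul"

text \<open>Both tests protect what follows them: division by zero is stuck, and
  \<open>Power_search\<close> runs forever on an element that is not a power of
  \<open>q\<close>.\<close>

definition Row :: prog where
  "Row = Seq (Fork (Seq (Fork arg0 (Fork arg1 Skip)) Lookup)
           (Fork (Seq (Fork arg0 (Fork arg2 Skip)) Lookup) Skip))
     (Cond (op2 FieldEq arg1 Zero_elem) Unsolvable
       (Cond (Seq (op2 FieldDiv arg0 arg1) (Prim FieldIsPowerOfQ))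
         (Fork (op2 IntSub (lit 0) (Seq (op2 FieldDiv arg0 arg1) Power_search)) (Fork (lit 1) arg2))
         Unsolvable))"

lemma sem_Unsolvable [simp]: "sem q Unsolvable v = Some (enc_ints [1])"
  by (simp add: Unsolvable_def)

locale non_root_of_unity =
  fixes q :: "'a::field"
  assumes q_nonzero [simp]: "q \<noteq> 0"
    and no_root: "\<And>k::nat. k > 0 \<Longrightarrow> q ^ k \<noteq> 1"
begin

lemma powi_inj:
  assumes "q powi a = q powi b"
  shows "a = b"
proof -
  have *: False if "q powi a = q powi b" "a < b" for a b :: int
  proof -
    have "q powi (b - a) = 1"
      using that by (simp add: power_int_diff)
    moreover have "q powi (b - a) = q ^ nat (b - a)"
      using that by (simp add: power_int_def)
    ultimately show False using no_root[of "nat (b - a)"] that by simp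
  qed
  show ?thesis using *[of a b] *[of b a] assms by fastforce
qed

lemma powi_eq_iff: "q powi a = q powi b \<longleftrightarrow> a = b"
  using powi_inj by blast

text \<open>Both signs are tried at once while \<open>j\<close> counts up from 0. By injectivity of
  the powers the loop stops exactly at \<open>j = \<bar>k\<bar>\<close>, and the final test finds
  the sign.\<close>

lemma sem_Power_search [simp]: "sem q Power_search (VElem (q powi k)) = Some (VInt k)"
proof -
  let ?C = "Cond (op2 FieldEq arg0 rest3) (lit 0) (Cond (op2 FieldEq arg1 rest3) (lit 0) (lit 1))"
  let ?B = "Fork (op2 FieldMul arg0 (Prim LitQ)) (Fork (op2 FieldDiv arg1 (Prim LitQ))
         (Fork (op2 IntAdd arg2 (lit 1)) rest3))"
  let ?E = "Cond (op2 FieldEq arg0 rest3) arg2 (op2 IntSub (lit 0) arg2)"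
  have "sem q (Seq (Loop ?C ?B) ?E) (VPair (VElem (q powi j)) (VPair (VElem (q powi (- j)))
      (VPair (VInt j) (VElem (q powi k))))) = Some (VInt k)" if "0 \<le> j" "j \<le> \<bar>k\<bar>" for j
    using that
  proof (induction "nat (\<bar>k\<bar> - j)" arbitrary: j rule: less_induct)
    case less
    show ?case
    proof (cases "k = j \<or> k = - j")
      case True
      then show ?thesis by (auto simp: sem_Loop powi_eq_iff simp del: power_int_minus)
    next
      case False
      then have "j + 1 \<le> \<bar>k\<bar>" using less.prems by linarith
      then have IH: "sem q (Seq (Loop ?C ?B) ?E) (VPair (VElem (q powi (j + 1)))
         (VPair (VElem (q powi (- (j + 1)))) (VPair (VInt (j + 1)) (VElem (q powi k))))) = Some (VInt k)"
        using less.prems by (intro less.hyps) auto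
      have "q powi (j + 1) = q powi j * q" "q powi (- (j + 1)) = q powi (- j) / q"
        using power_int_diff[of q "- j" 1] by (simp_all add: power_int_add del: power_int_minus)
      with IH False show ?thesis
        by (simp add: sem_Loop powi_eq_iff eq_commute[of _ k] del: power_int_minus)
    qed
  qed
  from this[of 0] show ?thesis by (simp add: Power_search_def)
qed

lemma sem_Row [simp]:
  assumes "\<And>\<beta>. \<beta> \<in> fst ` set fs \<Longrightarrow> length \<beta> = length \<alpha>"
    and "\<And>\<beta>. \<beta> \<in> fst ` set gs \<Longrightarrow> length \<beta> = length \<alpha>"
  shows "sem q Row (VPair (enc_ints (map int \<alpha>)) (VPair (enc_terms fs) (VPair (enc_terms gs) e))) =
    Some (enc_ints (row q \<alpha> (lookup_terms \<alpha> fs) (lookup_terms \<alpha> gs)))"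
proof -
  have the: "(THE k. q powi k' = q powi k) = k'" for k'
    using powi_eq_iff by auto
  note [simp] = sem_Lookup[OF assms(1), simplified] sem_Lookup[OF assms(2), simplified]
  show ?thesis
    by (auto simp: Row_def row_def the)
qed

end

section \<open>Lattices of integer vectors\<close>

text \<open>Vectors are functions on all of the naturals, so one module over the integers, with its
  library notion of span, serves every dimension; \<open>vec\<close> pads lists with zeros.\<close>

interpretation intvec: module "\<lambda>(c::int) (x :: nat \<Rightarrow> int) j. c * x j"
  by unfold_locales (auto simp: fun_eq_iff algebra_simps)

definition vec :: "int list \<Rightarrow> nat \<Rightarrow> int" where
  "vec xs j = (if j < length xs then xs ! j else 0)"

definition inner :: "int list \<Rightarrow> (nat \<Rightarrow> int) \<Rightarrow> int" where
  "inner r x = (\<Sum>j<length r. r ! j * x j)"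

definition lattice :: "int list list \<Rightarrow> (nat \<Rightarrow> int) set" where
  "lattice L = intvec.span (vec ` set L)"

lemma vec_Nil [simp]: "vec [] = 0"
  by (simp add: vec_def fun_eq_iff)

lemma vec_Cons_0 [simp]: "vec (x # xs) 0 = x"
  and vec_Cons_Suc [simp]: "vec (x # xs) (Suc j) = vec xs j"
  by (simp_all add: vec_def)

lemma inner_Nil [simp]: "inner [] x = 0"
  by (simp add: inner_def)

lemma inner_Cons [simp]: "inner (a # r) x = a * x 0 + inner r (\<lambda>j. x (Suc j))"
  by (simp add: inner_def sum.lessThan_Suc_shift del: sum.lessThan_Suc)

lemma inner_zero [simp]: "inner r 0 = 0"
  by (simp add: inner_def)

lemma inner_add [simp]: "inner r (x + y) = inner r x + inner r y"
  by (simp add: inner_def algebra_simps sum.distrib)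

lemma inner_scale [simp]: "inner r (\<lambda>j. c * x j) = c * inner r x"
  by (simp add: inner_def algebra_simps sum_distrib_left)

lemma inner_diff [simp]: "inner r (x - y) = inner r x - inner r y"
  by (simp add: inner_def algebra_simps sum_subtractf)

lemma subspace_inner: "intvec.subspace {x. inner r x = 0}"
  by (simp add: intvec.subspace_def)

lemma dot_eq_inner: "dot r xs = inner r (vec xs)"
proof (induction r xs rule: list_induct2')
  case (2 x xs)
  show ?case by (simp add: dot_def inner_def del: inner_Cons)
next
  case (4 x xs y ys)
  then show ?case by (simp add: dot_def)
qed (simp_all add: dot_def)

lemma length_lin [simp]: "length (lin s xs ys) = min (length xs) (length ys)"
  by (simp add: lin_def)

lemma vec_lin: "length xs = length ys \<Longrightarrow> vec (lin s xs ys) = (\<lambda>j. s * vec xs j) + vec ys"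
  by (auto simp: fun_eq_iff lin_def vec_def)

lemma inner_lin:
  "length xs = length ys \<Longrightarrow> inner r (vec (lin s xs ys)) = s * inner r (vec xs) + inner r (vec ys)"
  by (simp add: vec_lin)

text \<open>Adding a multiple of \<open>p\<close> to \<open>b\<close> is undone by subtracting it,
  so each generating set lies in the span of the other.\<close>

lemma lattice_lin:
  assumes "length p = length b"
  shows "lattice (p # lin s p b # D) = lattice (p # b # D)"
proof -
  let ?S = "vec ` set (p # lin s p b # D)" and ?T = "vec ` set (p # b # D)"
  have "vec (lin s p b) \<in> intvec.span ?T"
    unfolding vec_lin[OF assms]
    by (intro intvec.span_add intvec.span_scale intvec.span_base) auto
  moreover have "vec b \<in> intvec.span ?S"
  proof -
    have "vec (lin s p b) - (\<lambda>j. s * vec p j) \<in> intvec.span ?S"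
      by (intro intvec.span_diff intvec.span_scale intvec.span_base) auto
    then show ?thesis by (simp add: vec_lin[OF assms])
  qed
  ultimately show ?thesis
    unfolding lattice_def intvec.span_eq by (auto intro: intvec.span_base)
qed

section \<open>Intersecting a lattice with a hyperplane\<close>

text \<open>The loop body of \<open>Euclid\<close> works on
  \<open>(x, (y, (r, (p, (b, e)))))\<close>, where \<open>x\<close> and \<open>y\<close> are the
  values of \<open>r\<close> at \<open>p\<close> and \<open>b\<close>.\<close>

definition Swap :: prog where
  "Swap = Fork arg2 (Fork arg4 (Fork arg3 rest5))"

definition Euclid :: prog where
  "Euclid = Loop (Cond (eq0 (Seq (Fork arg0 rest2) Dot)) (lit 0) (lit 1))
     (Seq (Fork (Seq (Fork arg0 rest1) Dot) (Fork (Seq (Fork arg0 rest2) Dot) Skip))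
       (Cond (eq0 arg0) Swap
         (Cond (op2 IntLe (sqr arg0) (sqr arg1))
           (Fork arg2 (Fork arg3 (Fork
              (Seq (Fork (Cond (op2 IntLe (op2 IntMul arg0 arg1) (lit 0)) (lit 1) (lit (- 1)))
                     rest3) Lin) rest5)))
           Swap)))"

text \<open>A swap keeps the sum of the absolute values of \<open>r\<close> at \<open>p\<close> and \<open>b\<close>; the second summand of
  the termination measure makes it count as progress.\<close>

lemma sem_Euclid:
  assumes "length p = N" "length b = N"
  shows "\<exists>p' b'. sem q Euclid (VPair (enc_ints r) (VPair (enc_ints p) (VPair (enc_ints b) e))) =
      Some (VPair (enc_ints r) (VPair (enc_ints p') (VPair (enc_ints b') e))) \<and>
    length p' = N \<and> length b' = N \<and> inner r (vec b') = 0 \<and>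
    (\<forall>D. lattice (p' # b' # D) = lattice (p # b # D))"
  using assms
proof (induction "3 * nat (\<bar>inner r (vec p)\<bar> + \<bar>inner r (vec b)\<bar>) +
      (if inner r (vec p) = 0 then 2 else if \<bar>inner r (vec p)\<bar> \<le> \<bar>inner r (vec b)\<bar> then 0 else 1)"
    arbitrary: p b rule: less_induct)
  case less
  let ?\<alpha> = "inner r (vec p)" and ?\<beta> = "inner r (vec b)"
  have swap: "lattice (b # p # D) = lattice (p # b # D)" for D
    by (simp add: lattice_def insert_commute)
  \<comment> \<open>The program has no absolute value and compares squares instead.\<close>
  have le: "?\<alpha> * ?\<alpha> \<le> ?\<beta> * ?\<beta> \<longleftrightarrow> \<bar>?\<alpha>\<bar> \<le> \<bar>?\<beta>\<bar>"
    using abs_le_square_iff[of ?\<alpha> ?\<beta>] by (simp add: power2_eq_square)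
  consider "?\<beta> = 0" | "?\<beta> \<noteq> 0" "?\<alpha> = 0 \<or> \<bar>?\<alpha>\<bar> > \<bar>?\<beta>\<bar>" | "?\<beta> \<noteq> 0" "?\<alpha> \<noteq> 0" "\<bar>?\<alpha>\<bar> \<le> \<bar>?\<beta>\<bar>"
    by linarith
  then show ?case
  proof cases
    case 1
    then show ?thesis using less.prems
      by (intro exI[of _ p] exI[of _ b]) (simp add: Euclid_def sem_Loop dot_eq_inner)
  next
    case 2
    have "\<exists>p' b'. sem q Euclid (VPair (enc_ints r) (VPair (enc_ints b) (VPair (enc_ints p) e))) =
        Some (VPair (enc_ints r) (VPair (enc_ints p') (VPair (enc_ints b') e))) \<and>
      length p' = N \<and> length b' = N \<and> inner r (vec b') = 0 \<and>
      (\<forall>D. lattice (p' # b' # D) = lattice (b # p # D))"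
      by (rule less.hyps) (use 2 less.prems in auto)
    moreover have "sem q Euclid (VPair (enc_ints r) (VPair (enc_ints p) (VPair (enc_ints b) e))) =
      sem q Euclid (VPair (enc_ints r) (VPair (enc_ints b) (VPair (enc_ints p) e)))"
      unfolding Euclid_def
      \<comment> \<open>Only the loop on the left is unfolded, and only once; the guard has value 1
        here.\<close>
      by (subst (1) sem_Loop[where k = 1]) (use 2 in \<open>auto simp: dot_eq_inner le Swap_def\<close>)
    ultimately show ?thesis by (simp add: swap)
  next
    case 3
    \<comment> \<open>With this sign \<open>s * ?\<alpha>\<close> and \<open>?\<beta>\<close> do not
      have the same sign, so their sum has absolute value
      \<open>\<bar>?\<beta>\<bar> - \<bar>?\<alpha>\<bar>\<close>: one subtractive Euclidean
      step.\<close>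
    define s :: int where "s = (if ?\<alpha> * ?\<beta> \<le> 0 then 1 else - 1)"
    let ?b = "lin s p b"
    have ip: "inner r (vec ?b) = s * ?\<alpha> + ?\<beta>"
      using less.prems by (intro inner_lin) simp
    have "\<bar>inner r (vec ?b)\<bar> = \<bar>?\<beta>\<bar> - \<bar>?\<alpha>\<bar>"
      unfolding ip using 3 by (auto simp: s_def mult_le_0_iff abs_if split: if_splits)
    then have "\<exists>p' b'. sem q Euclid (VPair (enc_ints r) (VPair (enc_ints p) (VPair (enc_ints ?b) e))) =
        Some (VPair (enc_ints r) (VPair (enc_ints p') (VPair (enc_ints b') e))) \<and>
      length p' = N \<and> length b' = N \<and> inner r (vec b') = 0 \<and>
      (\<forall>D. lattice (p' # b' # D) = lattice (p # ?b # D))"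
      by (intro less.hyps) (use 3 less.prems in \<open>auto simp: nat_add_distrib\<close>)
    moreover have "sem q Euclid (VPair (enc_ints r) (VPair (enc_ints p) (VPair (enc_ints b) e))) =
      sem q Euclid (VPair (enc_ints r) (VPair (enc_ints p) (VPair (enc_ints ?b) e)))"
      unfolding Euclid_def
      by (subst (1) sem_Loop[where k = 1]) (use 3 in \<open>auto simp: dot_eq_inner le s_def\<close>)
    ultimately show ?thesis using less.prems by (simp add: lattice_lin)
  qed
qed

text \<open>A lattice is handed around as the nonempty list of its generators, pivot first.\<close>

abbreviation enc_vecs :: "int list list \<Rightarrow> 'a val" where
  "enc_vecs L \<equiv> enc_list (map enc_ints L)"

text \<open>The pivot meets every other generator once. A generator that it has met has value 0
  under \<open>r\<close> and is not touched again; the value at the pivot absorbs the rest.\<close>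

definition Reduce :: prog where
  "Reduce = Seq (Fork rest2 (Fork (Fork arg1 nul) arg0))
     (Fold (Seq (Seq (Fork rest2 (Fork (Seq arg1 arg0) (Fork arg0 (Seq arg1 rest1)))) Euclid) rest1))"

lemma span_insert_zero: "intvec.span (insert 0 S) = intvec.span S"
  unfolding intvec.span_eq by (auto intro: intvec.span_base intvec.span_zero)

lemma sem_Reduce:
  assumes "\<forall>b \<in> set (p # D). length b = N"
  shows "\<exists>p' D'. sem q Reduce (VPair (enc_ints r) (enc_vecs (p # D))) = Some (enc_vecs (p' # D')) \<and>
    (\<forall>b \<in> set (p' # D'). length b = N) \<and> (\<forall>b \<in> set D'. inner r (vec b) = 0) \<and>
    lattice (p' # D') = lattice (p # D)"
proof -
  let ?S = "Seq (Seq (Fork rest2 (Fork (Seq arg1 arg0) (Fork arg0 (Seq arg1 rest1)))) Euclid) rest1"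
  \<comment> \<open>\<open>D'\<close> holds the generators already met and \<open>B\<close> those
    still waiting. With the pivot they generate the original lattice at every stage.\<close>
  define I where "I vs a \<longleftrightarrow> (\<exists>p' D' B. a = enc_vecs (p' # D') \<and> vs = map enc_ints B \<and>
      (\<forall>b \<in> set (p' # D' @ B). length b = N) \<and> (\<forall>b \<in> set D'. inner r (vec b) = 0) \<and>
      lattice (p' # D' @ B) = lattice (p # D))" for vs :: "'a val list" and a :: "'a val"
  have "\<exists>a'. sem q (Fold ?S) (VPair (enc_list (map enc_ints D)) (VPair (enc_vecs [p]) (enc_ints r))) =
      Some a' \<and> I [] a'"
  proof (rule sem_Fold_rel)
    show "I (map enc_ints D) (enc_vecs [p])"
      unfolding I_def using assms by (intro exI[of _ p] exI[of _ "[]"] exI[of _ D]) auto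
    fix x :: "'a val" and xs a assume "I (x # xs) a"
    then obtain p1 D1 B1 where a: "a = enc_vecs (p1 # D1)" "x # xs = map enc_ints B1"
      "\<forall>b \<in> set (p1 # D1 @ B1). length b = N" "\<forall>b \<in> set D1. inner r (vec b) = 0"
      "lattice (p1 # D1 @ B1) = lattice (p # D)" unfolding I_def by (elim exE conjE) (rule that)
    from a(2) obtain b B where B: "B1 = b # B" "x = enc_ints b" "xs = map enc_ints B" by auto
    obtain p2 b2 where E: "sem q Euclid (VPair (enc_ints r) (VPair (enc_ints p1) (VPair (enc_ints b) (enc_vecs D1)))) =
        Some (VPair (enc_ints r) (VPair (enc_ints p2) (VPair (enc_ints b2) (enc_vecs D1))))"
      "length p2 = N" "length b2 = N" "inner r (vec b2) = 0"
      "\<And>D. lattice (p2 # b2 # D) = lattice (p1 # b # D)"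
      using sem_Euclid[of p1 N b q r "enc_vecs D1"] a(3) B(1) by auto
    have "lattice (p2 # (b2 # D1) @ B) = lattice (p # D)"
      using E(5)[of "D1 @ B"] a(5) B(1) by (simp add: lattice_def insert_commute)
    then have "I xs (enc_vecs (p2 # b2 # D1))"
      unfolding I_def using a E B by (intro exI[of _ p2] exI[of _ "b2 # D1"] exI[of _ B]) auto
    moreover have "sem q ?S (VPair x (VPair a (enc_ints r))) = Some (enc_vecs (p2 # b2 # D1))"
      using E(1) by (simp add: a(1) B(2))
    ultimately show "\<exists>a'. sem q ?S (VPair x (VPair a (enc_ints r))) = Some a' \<and> I xs a'" by blast
  qed
  then show ?thesis
    unfolding I_def by (auto simp: Reduce_def)
qed

lemma mem_lattice_Cons: "x \<in> lattice (p # D) \<longleftrightarrow> (\<exists>z. x - (\<lambda>j. z * vec p j) \<in> lattice D)"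
  by (simp add: lattice_def intvec.span_insert)

lemma lattice_inner_0:
  assumes "\<forall>b \<in> set D. inner r (vec b) = 0" "x \<in> lattice D"
  shows "inner r x = 0"
  using intvec.span_minimal[OF _ subspace_inner, of "vec ` set D" r] assms
  by (auto simp: lattice_def)

text \<open>A dropped pivot is replaced by the zero vector, so that the list of generators stays nonempty.\<close>

definition Kernel :: prog where
  "Kernel = Seq (Fork arg0 Reduce) (Cond (eq0 Dot) rest1
     (Fork (Seq (Fork (lit (- 1)) (Fork arg1 (Fork arg1 Skip))) Lin) rest2))"

text \<open>After \<open>Reduce\<close> only the pivot can lie off the hyperplane. If it does, a
  lattice vector on the hyperplane has pivot coefficient 0, because the integers have no zero
  divisors.\<close>

lemma sem_Kernel:
  assumes "\<forall>b \<in> set (p # D). length b = N"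
  shows "\<exists>p' D'. sem q Kernel (VPair (enc_ints r) (enc_vecs (p # D))) = Some (enc_vecs (p' # D')) \<and>
    (\<forall>b \<in> set (p' # D'). length b = N) \<and> lattice (p' # D') = lattice (p # D) \<inter> {x. inner r x = 0}"
proof -
  obtain p' D' where R: "sem q Reduce (VPair (enc_ints r) (enc_vecs (p # D))) = Some (enc_vecs (p' # D'))"
    "\<forall>b \<in> set (p' # D'). length b = N" "\<forall>b \<in> set D'. inner r (vec b) = 0"
    "lattice (p' # D') = lattice (p # D)"
    using sem_Reduce[OF assms] by blast
  show ?thesis
  proof (cases "inner r (vec p') = 0")
    case True
    have "inner r x = 0" if "x \<in> lattice (p' # D')" for x
      using True R(3) by (intro lattice_inner_0[OF _ that]) auto
    then have "lattice (p' # D') = lattice (p # D) \<inter> {x. inner r x = 0}"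
      unfolding R(4)[symmetric] by blast
    moreover have "sem q Kernel (VPair (enc_ints r) (enc_vecs (p # D))) = Some (enc_vecs (p' # D'))"
      using R(1) True by (simp add: Kernel_def dot_eq_inner)
    ultimately show ?thesis using R(2) by blast
  next
    case False
    have 0: "vec (lin (- 1) p' p') = 0"
      by (simp add: vec_lin fun_eq_iff)
    have "lattice (p # D) \<inter> {x. inner r x = 0} = lattice D'"
    proof (intro set_eqI iffI)
      fix x assume "x \<in> lattice (p # D) \<inter> {x. inner r x = 0}"
      then have "x \<in> lattice (p' # D')" and x: "inner r x = 0"
        unfolding R(4) by blast+
      then obtain z where z: "x - (\<lambda>j. z * vec p' j) \<in> lattice D'"
        unfolding mem_lattice_Cons by blast
      from lattice_inner_0[OF R(3) z] x have "z * inner r (vec p') = 0" by simp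
      with False have "z = 0" by simp
      moreover have "(\<lambda>j. 0 :: int) = (0 :: nat \<Rightarrow> int)" by (simp add: fun_eq_iff)
      ultimately show "x \<in> lattice D'" using z by simp
    next
      fix x assume "x \<in> lattice D'"
      moreover from this have "x \<in> lattice (p' # D')"
        using intvec.span_mono[of "vec ` set D'" "vec ` set (p' # D')"] by (auto simp: lattice_def)
      ultimately show "x \<in> lattice (p # D) \<inter> {x. inner r x = 0}"
        unfolding R(4)[symmetric] using lattice_inner_0[OF R(3)] by blast
    qed
    also have "lattice D' = lattice (lin (- 1) p' p' # D')"
      by (simp add: lattice_def 0 span_insert_zero)
    finally have "lattice (lin (- 1) p' p' # D') = lattice (p # D) \<inter> {x. inner r x = 0}" ..
    moreover have "sem q Kernel (VPair (enc_ints r) (enc_vecs (p # D))) =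
        Some (enc_vecs (lin (- 1) p' p' # D'))"
      using R(1) False by (simp add: Kernel_def dot_eq_inner)
    moreover have "\<forall>b \<in> set (lin (- 1) p' p' # D'). length b = N"
      using R(2) by simp
    ultimately show ?thesis by blast
  qed
qed

section \<open>Generators of the lattice of all integer vectors of a given length\<close>

definition Zeros :: prog where
  "Zeros = Seq (Seq (Fork Skip nul)
     (Loop (op2 IntLe (lit 1) arg0) (Fork (op2 IntSub arg0 (lit 1)) (Fork (lit 0) rest1)))) rest1"

lemma sem_Zeros [simp]: "sem q Zeros (VInt (int n)) = Some (enc_ints (replicate n 0))"
proof -
  have "sem q (Seq (Loop (op2 IntLe (lit 1) arg0) (Fork (op2 IntSub arg0 (lit 1)) (Fork (lit 0) rest1))) rest1)
     (VPair (VInt (int n)) (enc_ints (replicate m 0))) = Some (enc_ints (replicate (n + m) 0))" for m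
  proof (induction n arbitrary: m)
    case (Suc n)
    from Suc[of "Suc m"] show ?case by (simp add: sem_Loop)
  qed (simp add: sem_Loop)
  from this[of 0] show ?thesis by (simp add: Zeros_def)
qed

text \<open>Passes from dimension n to n + 1. The head of the list is kept as the zero vector, from
  which the new unit vector is made; the old unit vectors get a leading 0, and the fold reverses
  them.\<close>

definition unit_step :: "int list list \<Rightarrow> int list list" where
  "unit_step L = (0 # hd L) # rev (map ((#) 0) (tl L)) @ [1 # hd L]"

definition Units :: prog where
  "Units = Seq (Fork Zeros (Fork (Fork nul nul) Skip))
     (Fold (Fork (Fork (lit 0) (Seq arg1 arg0))
        (Seq (Fork (Seq arg1 rest1) (Fork (Fork (Fork (lit 1) (Seq arg1 arg0)) nul) Skip))
           (Fold (Fork (Fork (lit 0) arg0) arg1)))))"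

definition units :: "nat \<Rightarrow> int list list" where
  "units n = (unit_step ^^ n) [[]]"

lemma units_0 [simp]: "units 0 = [[]]"
  and units_Suc [simp]: "units (Suc n) = unit_step (units n)"
  by (simp_all add: units_def)

lemma hd_units [simp]: "hd (units n) = replicate n 0"
  by (induction n) (auto simp: unit_step_def)

lemma units_nonempty [simp]: "units n \<noteq> []"
  by (cases n) (auto simp: unit_step_def)

lemma length_units: "\<forall>b \<in> set (units n). length b = n"
proof (induction n)
  case (Suc n)
  then show ?case
    using list.set_sel(2)[of "units n"] by (auto simp: unit_step_def)
qed simp

lemma vec_zeros: "vec (replicate n 0) = 0"
  by (simp add: vec_def fun_eq_iff)

lemma vec_tl_units: "vec ` set (tl (units n)) = (\<lambda>i j. if j = i then 1 else 0) ` {..<n}"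
proof (induction n)
  case (Suc n)
  have 1: "vec (1 # replicate n 0) = (\<lambda>j. if j = 0 then 1 else 0)"
    by (auto simp: vec_def fun_eq_iff nth_Cons')
  have 2: "vec (0 # b) = (\<lambda>j. case j of 0 \<Rightarrow> 0 | Suc j \<Rightarrow> vec b j)" for b
    by (auto simp: fun_eq_iff split: nat.split)
  have "vec ` (#) 0 ` set (tl (units n)) =
      (\<lambda>x j. case j of 0 \<Rightarrow> 0 | Suc j \<Rightarrow> x j) ` vec ` set (tl (units n))"
    by (simp add: image_image 2)
  also have "\<dots> = (\<lambda>i j. if j = i then 1 else 0) ` Suc ` {..<n}"
    unfolding Suc by (auto simp: image_image fun_eq_iff split: nat.split intro!: image_cong)
  finally show ?case
    by (simp add: unit_step_def 1 lessThan_Suc_eq_insert_0)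
qed simp

lemma lattice_units: "lattice (units n) = {x. \<forall>j\<ge>n. x j = 0}"
proof -
  let ?e = "\<lambda>i j :: nat. if j = i then 1 else (0 :: int)"
  have "lattice (units n) = lattice (hd (units n) # tl (units n))"
    by (simp del: hd_units)
  also have "\<dots> = intvec.span (?e ` {..<n})"
    by (simp add: lattice_def vec_zeros span_insert_zero vec_tl_units)
  also have "\<dots> = {x. \<forall>j\<ge>n. x j = 0}"
  proof
    show "intvec.span (?e ` {..<n}) \<subseteq> {x. \<forall>j\<ge>n. x j = 0}"
      by (rule intvec.span_minimal) (auto simp: intvec.subspace_def)
    show "{x. \<forall>j\<ge>n. x j = 0} \<subseteq> intvec.span (?e ` {..<n})"
    proof
      fix x :: "nat \<Rightarrow> int" assume x: "x \<in> {x. \<forall>j\<ge>n. x j = 0}"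
      have app: "(\<Sum>i\<in>A. f i) j = (\<Sum>i\<in>A. f i j)" for f :: "nat \<Rightarrow> nat \<Rightarrow> int" and A j
        by (induction A rule: infinite_finite_induct) auto
      have "x = (\<Sum>i<n. (\<lambda>j. x i * ?e i j))"
      proof
        fix j show "x j = (\<Sum>i<n. (\<lambda>j. x i * ?e i j)) j"
          using x by (auto simp: app if_distrib cong: if_cong)
      qed
      also have "\<dots> \<in> intvec.span (?e ` {..<n})"
        by (intro intvec.span_sum intvec.span_scale intvec.span_base) auto
      finally show "x \<in> intvec.span (?e ` {..<n})" .
    qed
  qed
  finally show ?thesis .
qed

lemma sem_Units [simp]: "sem q Units (VInt (int n)) = Some (enc_vecs (units n))"
proof -
  let ?T = "Fold (Fork (Fork (lit 0) arg0) arg1)"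
  let ?S = "Fork (Fork (lit 0) (Seq arg1 arg0))
        (Seq (Fork (Seq arg1 rest1) (Fork (Fork (Fork (lit 1) (Seq arg1 arg0)) nul) Skip)) ?T)"
  have T: "sem q ?T (VPair (enc_vecs D) (VPair (enc_vecs a) e)) =
      Some (enc_vecs (rev (map ((#) 0) D) @ a))" for D a and e :: "'a val"
    unfolding fold_Cons_map[symmetric] by (rule sem_Fold[where ea = enc_vecs]) simp
  have S: "sem q ?S (VPair x (VPair (enc_vecs L) e)) = Some (enc_vecs (unit_step L))"
    if "L \<noteq> []" for L and x e :: "'a val"
    using that T[of "tl L" "[1 # hd L]"] by (cases L) (simp_all add: unit_step_def)
  define I where "I vs a \<longleftrightarrow> (\<exists>m. m + length vs = n \<and> a = enc_vecs (units m))"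
    for vs :: "'a val list" and a :: "'a val"
  have "\<exists>a'. sem q (Fold ?S) (VPair (enc_list (map VInt (replicate n 0))) (VPair (enc_vecs [[]]) (VInt (int n)))) =
      Some a' \<and> I [] a'"
  proof (rule sem_Fold_rel)
    show "I (map VInt (replicate n 0)) (enc_vecs [[]])"
      unfolding I_def by (intro exI[of _ 0]) simp
    fix x :: "'a val" and xs a assume "I (x # xs) a"
    then obtain m where m: "m + length (x # xs) = n" "a = enc_vecs (units m)"
      unfolding I_def by blast
    then have "I xs (enc_vecs (unit_step (units m)))"
      unfolding I_def by (intro exI[of _ "Suc m"]) simp
    with S[of "units m"] m(2) show "\<exists>a'. sem q ?S (VPair x (VPair a (VInt (int n)))) = Some a' \<and> I xs a'"
      by auto
  qed
  then show ?thesis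
    by (auto simp: Units_def I_def enc_ints_def)
qed

section \<open>The action of the shifts on coefficients\<close>

lemma lookup_Const_mult:
  "Poly_Mapping.lookup (Const c * p) m = c * Poly_Mapping.lookup p m" for c :: "'a::comm_ring_1"
proof -
  have "Const c * p = Poly_Mapping.map ((*) c) p"
    by (simp add: Const_def mult_map_scale_conv_mult)
  then show ?thesis by (simp add: Poly_Mapping.map.rep_eq when_def)
qed

lemma sum_single_keys:
  "(\<Sum>j\<in>Poly_Mapping.keys m. Poly_Mapping.single j (Poly_Mapping.lookup m j)) = m"
  by (rule poly_mapping_eqI) (simp add: lookup_sum lookup_single when_def in_keys_iff)

lemma single_power:
  "Poly_Mapping.single (Poly_Mapping.single j 1) c ^ k =
     Poly_Mapping.single (Poly_Mapping.single j k) (c ^ k)" for c :: "'a::comm_ring_1" and k :: nat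
proof (induction k)
  case 0
  then show ?case by (simp add: single_one)
next
  case (Suc k)
  then show ?case by (simp add: mult_single single_add[symmetric])
qed

lemma prod_single_power:
  "finite A \<Longrightarrow> (\<Prod>j\<in>A. Poly_Mapping.single (Poly_Mapping.single j 1) (c j) ^ k j) =
     Poly_Mapping.single (\<Sum>j\<in>A. Poly_Mapping.single j (k j)) (\<Prod>j\<in>A. c j ^ k j)"
  for c :: "nat \<Rightarrow> 'a::comm_ring_1" and k :: "nat \<Rightarrow> nat"
proof (induction A rule: finite_induct)
  case empty
  then show ?case by (simp add: single_one)
next
  case (insert x A)
  then show ?case by (simp add: mult_single single_power del: One_nat_def)
qed

text \<open>Substitution sends each monomial to a scalar multiple of itself, so the shifts act
  diagonally on coefficients.\<close>

lemma lookup_tau: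
  "Poly_Mapping.lookup (tau q i p) m = q ^ Poly_Mapping.lookup m i * Poly_Mapping.lookup p m"
proof -
  have var: "(if j = i then Const q * Var i else Var j) =
      Poly_Mapping.single (Poly_Mapping.single j 1) (if j = i then q else 1)" for j
    by (auto simp: Const_def Var_def mult_single)
  have monom: "(\<Prod>j\<in>Poly_Mapping.keys m.
      (if j = i then Const q * Var i else Var j) ^ Poly_Mapping.lookup m j) =
      Poly_Mapping.single m (q ^ Poly_Mapping.lookup m i)" for m
  proof -
    have "(\<Prod>j\<in>Poly_Mapping.keys m. (if j = i then q else 1) ^ Poly_Mapping.lookup m j) =
        (\<Prod>j\<in>Poly_Mapping.keys m. if j = i then q ^ Poly_Mapping.lookup m j else 1)"
      by (intro prod.cong) auto
    also have "\<dots> = q ^ Poly_Mapping.lookup m i"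
      by (simp add: in_keys_iff)
    finally show ?thesis
      unfolding var by (simp add: prod_single_power sum_single_keys del: One_nat_def)
  qed
  show ?thesis
    unfolding tau_def psubst_def monom
    by (simp add: Const_def mult_single lookup_sum lookup_single when_def in_keys_iff mult.commute)
qed

text \<open>The diagonal action shows that the \<open>inv\<close> in \<open>tau_pow\<close> is a
  genuine two-sided inverse.\<close>

lemma inv_tau: "q \<noteq> 0 \<Longrightarrow> inv (tau q i) = tau (inverse q) i"
  by (rule inv_equality) (auto intro!: poly_mapping_eqI simp: lookup_tau power_inverse)

lemma lookup_tau_power:
  "Poly_Mapping.lookup ((tau q i ^^ k) p) m =
     (q ^ k) ^ Poly_Mapping.lookup m i * Poly_Mapping.lookup p m"
  by (induction k) (simp_all add: lookup_tau power_mult_distrib)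

lemma lookup_tau_pow:
  assumes "q \<noteq> 0"
  shows "Poly_Mapping.lookup (tau_pow q i l p) m =
    q powi (l * int (Poly_Mapping.lookup m i)) * Poly_Mapping.lookup p m"
  unfolding power_int_mult power_int_of_nat
  using assms by (simp add: tau_pow_def inv_tau lookup_tau_power power_int_def[of q l])

lemma lookup_tau_prod:
  assumes "q \<noteq> 0"
  shows "Poly_Mapping.lookup (tau_prod q n ls p) m =
    q powi (\<Sum>i<n. ls ! i * int (Poly_Mapping.lookup m i)) * Poly_Mapping.lookup p m"
proof -
  have "Poly_Mapping.lookup (foldr (\<lambda>i. tau_pow q i (ls ! i)) is p) m =
      q powi (\<Sum>i\<leftarrow>is. ls ! i * int (Poly_Mapping.lookup m i)) * Poly_Mapping.lookup p m" for "is"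
    using assms by (induction "is") (simp_all add: lookup_tau_pow power_int_add)
  then show ?thesis
    by (simp add: tau_prod_def interv_sum_list_conv_sum_set_nat atLeast0LessThan)
qed

lemma mem_qDisp_iff:
  assumes "q \<noteq> 0" "length ls = n"
  shows "l # ls \<in> qDisp n q f g \<longleftrightarrow> (\<forall>m. Poly_Mapping.lookup f m =
    q powi (l + (\<Sum>i<n. ls ! i * int (Poly_Mapping.lookup m i))) * Poly_Mapping.lookup g m)"
  using assms by (simp add: qDisp_def poly_mapping_eq_iff fun_eq_iff lookup_Const_mult
      lookup_tau_prod power_int_add mult.assoc)

text \<open>A monomial in the first \<open>n\<close> variables is determined by its first
  \<open>n\<close> exponents. Hence every matching entry of \<open>ts\<close> carries the same
  coefficient, and the order of \<open>ts\<close> does not matter.\<close>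

lemma lookup_terms_eq:
  assumes p: "p \<in> polys n" and ts: "term_list n p ts" and m: "Poly_Mapping.keys m \<subseteq> {..<n}"
  shows "lookup_terms (map (Poly_Mapping.lookup m) [0..<n]) ts = Poly_Mapping.lookup p m"
proof -
  let ?v = "\<lambda>m. map (Poly_Mapping.lookup m) [0..<n]"
  have inj: "m1 = m2" if "?v m1 = ?v m2"
      "Poly_Mapping.keys m1 \<subseteq> {..<n}" "Poly_Mapping.keys m2 \<subseteq> {..<n}" for m1 m2 :: "nat \<Rightarrow>\<^sub>0 nat"
  proof (rule poly_mapping_eqI)
    fix j
    show "Poly_Mapping.lookup m1 j = Poly_Mapping.lookup m2 j"
    proof (cases "j < n")
      case False
      then have "j \<notin> Poly_Mapping.keys m1" "j \<notin> Poly_Mapping.keys m2"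
        using that(2,3) by auto
      then show ?thesis by (simp only: in_keys_iff not_not)
    qed (use that(1) in simp)
  qed
  have mem: "(?v m, d) \<in> set ts \<longleftrightarrow> d \<noteq> 0 \<and> d = Poly_Mapping.lookup p m" for d
  proof
    assume "(?v m, d) \<in> set ts"
    then obtain m' where m': "m' \<in> Poly_Mapping.keys p" "?v m = ?v m'" "d = Poly_Mapping.lookup p m'"
      using ts by (auto simp: term_list_def)
    then have "m = m'"
      using p by (intro inj m) (auto simp: polys_def)
    with m' show "d \<noteq> 0 \<and> d = Poly_Mapping.lookup p m"
      by (simp add: in_keys_iff)
  next
    assume "d \<noteq> 0 \<and> d = Poly_Mapping.lookup p m"
    then show "(?v m, d) \<in> set ts"
      using ts by (auto simp: term_list_def in_keys_iff)
  qed
  have "fold (\<lambda>(\<beta>, d) a. if ?v m = \<beta> then d else a) ts' a =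
      (if \<exists>d. (?v m, d) \<in> set ts' then Poly_Mapping.lookup p m else a)"
    if "set ts' \<subseteq> set ts" for ts' a
    using that
  proof (induction ts' arbitrary: a)
    case (Cons t ts')
    obtain \<beta> d where t: "t = (\<beta>, d)" by (cases t)
    have "d = Poly_Mapping.lookup p m" if "?v m = \<beta>"
      using Cons.prems mem[of d] that t by simp
    with Cons.IH Cons.prems t show ?case by auto
  qed simp
  from this[of ts 0] have "lookup_terms (?v m) ts =
      (if \<exists>d. (?v m, d) \<in> set ts then Poly_Mapping.lookup p m else 0)"
    by (simp add: lookup_terms_def)
  then show ?thesis unfolding mem by auto
qed

section \<open>The coset of solutions\<close>

text \<open>The output format has one coefficient per list position, repetitions included, whereas
  \<open>lattice\<close> is the span of a set; induction on the list joins the two.\<close>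

lemma lattice_eq_sums:
  "lattice L = {x. \<exists>z. \<forall>j. x j = (\<Sum>k<length L. z k * vec (L ! k) j)}"
proof (induction L)
  case Nil
  then show ?case by (auto simp: lattice_def fun_eq_iff)
next
  case (Cons b L)
  show ?case
  proof (intro set_eqI iffI)
    fix x assume "x \<in> lattice (b # L)"
    then obtain c where "x - (\<lambda>j. c * vec b j) \<in> lattice L"
      unfolding mem_lattice_Cons by blast
    then obtain z where z: "\<And>j. x j - c * vec b j = (\<Sum>k<length L. z k * vec (L ! k) j)"
      unfolding Cons by auto
    have "x j = (\<Sum>k<length (b # L). (case k of 0 \<Rightarrow> c | Suc k \<Rightarrow> z k) * vec ((b # L) ! k) j)" for j
      using z[of j] by (simp add: sum.lessThan_Suc_shift del: sum.lessThan_Suc)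
    then show "x \<in> {x. \<exists>z. \<forall>j. x j = (\<Sum>k<length (b # L). z k * vec ((b # L) ! k) j)}"
      by blast
  next
    fix x assume "x \<in> {x. \<exists>z. \<forall>j. x j = (\<Sum>k<length (b # L). z k * vec ((b # L) ! k) j)}"
    then obtain z where z: "\<And>j. x j = (\<Sum>k<length (b # L). z k * vec ((b # L) ! k) j)"
      by blast
    have "x - (\<lambda>j. z 0 * vec b j) \<in> lattice L"
      unfolding Cons by (auto simp: z sum.lessThan_Suc_shift simp del: sum.lessThan_Suc intro!: exI[of _ "\<lambda>k. z (Suc k)"])
    then show "x \<in> lattice (b # L)"
      unfolding mem_lattice_Cons by blast
  qed
qed

text \<open>Homogenisation: the base point gets first coordinate 1 and the generators get 0, so that
  the coset becomes a slice at \<open>t = 1\<close>.\<close>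

lemma desc_set_eq_lattice:
  assumes "\<forall>b \<in> set bs. length b = length v"
  shows "desc_set (Some (v, bs)) =
    {ys. length ys = length v \<and> vec (1 # ys) - vec (1 # v) \<in> lattice (map ((#) 0) bs)}"
proof -
  have "ys = map (\<lambda>j. v ! j + (\<Sum>k<length bs. z k * bs ! k ! j)) [0..<length v] \<longleftrightarrow>
      length ys = length v \<and> (\<forall>j. vec (1 # ys) j - vec (1 # v) j =
        (\<Sum>k<length bs. z k * vec (0 # bs ! k) j))" (is "?A \<longleftrightarrow> ?B") for ys and z :: "nat \<Rightarrow> int"
  proof
    assume ?A
    then show ?B
      using assms by (auto simp: vec_def nth_Cons' intro!: sum.cong)
  next
    assume B: ?B
    have "ys ! j = v ! j + (\<Sum>k<length bs. z k * bs ! k ! j)" if "j < length v" for j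
    proof -
      have "vec (1 # ys) (Suc j) - vec (1 # v) (Suc j) = (\<Sum>k<length bs. z k * vec (0 # bs ! k) (Suc j))"
        using B by blast
      then have "ys ! j - v ! j = (\<Sum>k<length bs. z k * vec (bs ! k) j)"
        using B that by (simp add: vec_def[of ys] vec_def[of v])
      also have "\<dots> = (\<Sum>k<length bs. z k * bs ! k ! j)"
        using assms that by (intro sum.cong) (auto simp: vec_def)
      finally show ?thesis by simp
    qed
    with B show ?A by (auto intro!: nth_equalityI)
  qed
  then show ?thesis
    by (auto simp: lattice_eq_sums)
qed

text \<open>The equation \<open>[1]\<close> reads off the coordinate \<open>t\<close>. If the pivot
  has \<open>t * t = 1\<close>, then \<open>Lin\<close> with scalar \<open>t - 1\<close> applied to
  two copies of it gives \<open>t\<close> times the pivot, whose first coordinate is 1.\<close>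

definition Output :: prog where
  "Output = Seq (Seq (Fork Unsolvable Skip) (Seq (Fork arg0 Reduce) (Fork Dot Skip)))
     (Cond (eq0 (op2 IntSub (sqr arg0) (lit 1)))
       (Fork (Seq (Seq (Fork (op2 IntSub arg0 (lit 1)) (Fork arg2 (Fork arg2 Skip))) Lin) rest1)
         (Seq (Fork rest3 (Fork nul Skip)) (Fold (Fork (Seq arg0 rest1) arg1))))
       nul)"

lemma square_eq_1_if_mult_eq_1: "x * t = 1 \<Longrightarrow> t * t = 1" for x t :: int
  by (auto simp: zmult_eq_1_iff)

lemma Snd_enc_ints: "xs \<noteq> [] \<Longrightarrow> apply_prim q Snd (enc_ints xs) = Some (enc_ints (tl xs))"
  by (cases xs) simp_all

text \<open>A vector with first coordinate 1 is \<open>z\<close> times the reduced pivot plus a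
  vector with first coordinate 0. Thus \<open>z * t = 1\<close>, which forces \<open>t\<close> to be
  1 or -1 and \<open>z = t\<close>.\<close>

lemma sem_Output:
  assumes "\<forall>b \<in> set (p # D). length b = Suc N"
  shows "\<exists>C. sem (q :: 'a::field) Output (enc_vecs (p # D)) = Some (enc_desc C) \<and> wf_desc N C \<and>
    desc_set C = {ys. length ys = N \<and> vec (1 # ys) \<in> lattice (p # D)}"
proof -
  obtain p' D' where R: "sem q Reduce (VPair (enc_ints [1]) (enc_vecs (p # D))) = Some (enc_vecs (p' # D'))"
    "\<forall>b \<in> set (p' # D'). length b = Suc N" "\<forall>b \<in> set D'. inner [1] (vec b) = 0"
    "lattice (p' # D') = lattice (p # D)"
    using sem_Reduce[OF assms] by blast
  define t where "t = vec p' 0"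
  have Dot: "sem q Dot (VPair (VPair (VInt 1) VNull) (VPair (enc_ints p') e)) = Some (VInt t)"
    for e :: "'a val"
    using sem_Dot[of q "[1]" p' e] by (simp add: dot_eq_inner t_def)
  have z: "z * t = 1" if "vec (1 # ys) - (\<lambda>j. z * vec p' j) \<in> lattice D'" for ys z
    using lattice_inner_0[OF R(3) that] by (simp add: t_def)
  show ?thesis
  proof (cases "t * t = 1")
    case False
    then have "vec (1 # ys) \<notin> lattice (p # D)" for ys
      using z square_eq_1_if_mult_eq_1 unfolding R(4)[symmetric] mem_lattice_Cons by blast
    moreover have "sem q Output (enc_vecs (p # D)) = Some (enc_desc None)"
      using R(1) False by (simp add: Output_def Dot)
    ultimately show ?thesis by (intro exI[of _ None]) simp
  next
    case True
    define w where "w = lin (t - 1) p' p'"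
    define bs where "bs = rev (map tl D')"
    have w: "length w = Suc N" "vec w = (\<lambda>j. t * vec p' j)"
      using R(2) by (auto simp: w_def vec_lin fun_eq_iff algebra_simps)
    have "vec w 0 = 1"
      using True by (simp add: w(2) t_def)
    with w(1) have w1: "w = 1 # tl w"
      by (cases w) simp_all
    have fold: "sem q (Fold (Fork (Seq arg0 rest1) arg1)) (VPair (enc_vecs D') (VPair (enc_vecs []) e)) =
        Some (enc_vecs (fold (\<lambda>b a. tl b # a) D' []))" for e :: "'a val"
    proof (rule sem_Fold[where ea = enc_vecs])
      fix b a assume "b \<in> set D'"
      then have "b \<noteq> []"
        using R(2) by auto
      then show "sem q (Fork (Seq arg0 rest1) arg1) (VPair (enc_ints b) (VPair (enc_vecs a) e)) =
          Some (enc_vecs (tl b # a))"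
        by (simp add: Snd_enc_ints)
    qed
    have tl_w: "apply_prim q Snd (enc_ints w) = Some (enc_ints (tl w))"
      using w(1) by (intro Snd_enc_ints) auto
    have "sem q Output (enc_vecs (p # D)) = Some (enc_desc (Some (tl w, bs)))"
      using R(1) True fold tl_w
      by (simp add: Output_def Dot w_def[symmetric] fold_Cons_map bs_def)
    moreover have wf: "wf_desc N (Some (tl w, bs))"
      using w(1) R(2) by (auto simp: bs_def)
    moreover have "desc_set (Some (tl w, bs)) = {ys. length ys = N \<and> vec (1 # ys) \<in> lattice (p # D)}"
    proof -
      have "(0 # tl b) = b" if "b \<in> set D'" for b
        using R(2,3) that by (cases b) auto
      then have "set (map ((#) 0) bs) = set D'"
        by (force simp: bs_def image_image)
      then have L: "lattice (map ((#) 0) bs) = lattice D'"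
        by (simp only: lattice_def)
      have "vec (1 # ys) \<in> lattice (p # D) \<longleftrightarrow> vec (1 # ys) - vec w \<in> lattice D'" for ys
      proof -
        have "z = t" if "vec (1 # ys) - (\<lambda>j. z * vec p' j) \<in> lattice D'" for z
        proof -
          have "z = z * t * t" using True by (simp add: mult.assoc)
          with z[OF that] show ?thesis by simp
        qed
        then show ?thesis
          unfolding R(4)[symmetric] mem_lattice_Cons w(2) by metis
      qed
      then show ?thesis
        using wf w(1) by (subst desc_set_eq_lattice) (auto simp: L w1[symmetric])
    qed
    ultimately show ?thesis by blast
  qed
qed

section \<open>The decision procedure\<close>

text \<open>Coefficients are looked up in both term lists, so a monomial present in only one
  polynomial gets coefficient 0 in the other.\<close>

definition Step :: prog where
  "Step = Seq (Fork (Seq (Fork (Seq arg0 arg0) (Fork (Seq rest2 arg1) (Fork (Seq rest2 rest2) Skip))) Row)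
     arg1) Kernel"

text \<open>The dimension \<open>n + 2\<close> counts \<open>t\<close>, \<open>l\<close> and the
  \<open>n\<close> shift exponents. A monomial common to both polynomials imposes its equation
  twice, which changes nothing.\<close>

definition Solve :: prog where
  "Solve = Seq (Seq (Fork (Seq (Fork arg1 (Fork (Seq (op2 IntAdd arg0 (lit 2)) Units) Skip)) (Fold Step))
       Skip)
     (Seq (Fork rest3 (Fork arg0 rest1)) (Fold Step))) Output"

context non_root_of_unity
begin

lemma sem_Fold_Step:
  assumes fs: "\<And>\<beta>. \<beta> \<in> fst ` set fs \<Longrightarrow> length \<beta> = n"
    and gs: "\<And>\<beta>. \<beta> \<in> fst ` set gs \<Longrightarrow> length \<beta> = n"
    and ts: "\<And>\<beta>. \<beta> \<in> fst ` set ts \<Longrightarrow> length \<beta> = n"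
    and "\<forall>b \<in> set (p # D). length b = N"
  shows "\<exists>p' D'. sem q (Fold Step) (VPair (enc_terms ts) (VPair (enc_vecs (p # D)) (enc_input n fs gs))) =
      Some (enc_vecs (p' # D')) \<and> (\<forall>b \<in> set (p' # D'). length b = N) \<and>
    lattice (p' # D') = lattice (p # D) \<inter>
      {x. \<forall>\<alpha> \<in> fst ` set ts. inner (row q \<alpha> (lookup_terms \<alpha> fs) (lookup_terms \<alpha> gs)) x = 0}"
  using ts assms(4)
proof (induction ts arbitrary: p D)
  case Nil
  then show ?case
    by (intro exI[of _ p] exI[of _ D]) (simp add: sem_Fold_Nil enc_terms_def)
next
  case (Cons t ts)
  obtain \<alpha> c where t: "t = (\<alpha>, c)" by (cases t)
  let ?r = "row q \<alpha> (lookup_terms \<alpha> fs) (lookup_terms \<alpha> gs)"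
  obtain p1 D1 where K: "sem q Kernel (VPair (enc_ints ?r) (enc_vecs (p # D))) = Some (enc_vecs (p1 # D1))"
    "\<forall>b \<in> set (p1 # D1). length b = N" "lattice (p1 # D1) = lattice (p # D) \<inter> {x. inner ?r x = 0}"
    using sem_Kernel[OF Cons.prems(2)] by blast
  obtain p2 D2 where IH: "sem q (Fold Step) (VPair (enc_terms ts) (VPair (enc_vecs (p1 # D1)) (enc_input n fs gs))) =
      Some (enc_vecs (p2 # D2))" "\<forall>b \<in> set (p2 # D2). length b = N"
    "lattice (p2 # D2) = lattice (p1 # D1) \<inter>
      {x. \<forall>\<alpha> \<in> fst ` set ts. inner (row q \<alpha> (lookup_terms \<alpha> fs) (lookup_terms \<alpha> gs)) x = 0}"
    using Cons.IH[OF Cons.prems(1) K(2)] by auto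
  have \<alpha>: "length \<alpha> = n" using Cons.prems(1) t by auto
  have Row: "sem q Row (VPair (enc_ints (map int \<alpha>)) (VPair (enc_terms fs) (VPair (enc_terms gs) e))) =
      Some (enc_ints ?r)" for e
    using fs gs \<alpha> by (intro sem_Row) auto
  have "sem q Step (VPair (VPair (enc_ints (map int \<alpha>)) (VElem c)) (VPair (enc_vecs (p # D)) (enc_input n fs gs))) =
      Some (enc_vecs (p1 # D1))"
    using K(1) by (simp add: Step_def enc_input_def Row)
  then have "sem q (Fold Step) (VPair (enc_terms (t # ts)) (VPair (enc_vecs (p # D)) (enc_input n fs gs))) =
      Some (enc_vecs (p2 # D2))"
    using IH(1) by (simp add: enc_terms_def t sem_Fold_Cons)
  moreover have "lattice (p2 # D2) = lattice (p # D) \<inter>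
      {x. \<forall>\<alpha> \<in> fst ` set (t # ts). inner (row q \<alpha> (lookup_terms \<alpha> fs) (lookup_terms \<alpha> gs)) x = 0}"
    unfolding IH(3) K(3) t by auto
  ultimately show ?case using IH(2) by blast
qed

lemma sem_Solve:
  assumes fs: "\<And>\<beta>. \<beta> \<in> fst ` set fs \<Longrightarrow> length \<beta> = n"
    and gs: "\<And>\<beta>. \<beta> \<in> fst ` set gs \<Longrightarrow> length \<beta> = n"
  shows "\<exists>C. sem q Solve (enc_input n fs gs) = Some (enc_desc C) \<and> wf_desc (n + 1) C \<and>
    desc_set C = {ys. length ys = n + 1 \<and> (\<forall>\<alpha> \<in> fst ` (set fs \<union> set gs).
      inner (row q \<alpha> (lookup_terms \<alpha> fs) (lookup_terms \<alpha> gs)) (vec (1 # ys)) = 0)}"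
proof -
  obtain p D where U: "units (n + 2) = p # D"
    using units_nonempty list.exhaust by blast
  have U': "sem q Units (VInt (int n + 2)) = Some (enc_vecs (p # D))"
    using sem_Units[of q "n + 2"] unfolding U by (simp add: add.commute)
  have len: "\<forall>b \<in> set (p # D). length b = n + 2"
    using length_units[of "n + 2"] unfolding U .
  obtain p1 D1 where F: "sem q (Fold Step) (VPair (enc_terms fs) (VPair (enc_vecs (p # D)) (enc_input n fs gs))) =
      Some (enc_vecs (p1 # D1))" "\<forall>b \<in> set (p1 # D1). length b = n + 2"
      "lattice (p1 # D1) = lattice (p # D) \<inter>
      {x. \<forall>\<alpha> \<in> fst ` set fs. inner (row q \<alpha> (lookup_terms \<alpha> fs) (lookup_terms \<alpha> gs)) x = 0}"
    using sem_Fold_Step[OF fs gs fs len] by blast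
  obtain p2 D2 where G: "sem q (Fold Step) (VPair (enc_terms gs) (VPair (enc_vecs (p1 # D1)) (enc_input n fs gs))) =
      Some (enc_vecs (p2 # D2))" "\<forall>b \<in> set (p2 # D2). length b = n + 2"
      "lattice (p2 # D2) = lattice (p1 # D1) \<inter>
      {x. \<forall>\<alpha> \<in> fst ` set gs. inner (row q \<alpha> (lookup_terms \<alpha> fs) (lookup_terms \<alpha> gs)) x = 0}"
    using sem_Fold_Step[OF fs gs gs F(2)] by blast
  have "\<forall>b \<in> set (p2 # D2). length b = Suc (n + 1)"
    using G(2) by simp
  then obtain C where C: "sem q Output (enc_vecs (p2 # D2)) = Some (enc_desc C)" "wf_desc (n + 1) C"
    "desc_set C = {ys. length ys = n + 1 \<and> vec (1 # ys) \<in> lattice (p2 # D2)}"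
    using sem_Output[of p2 D2 "n + 1" q] by blast
  have "sem q Solve (enc_input n fs gs) = Some (enc_desc C)"
    using U' F(1) G(1) C(1) by (simp add: Solve_def enc_input_def)
  moreover have "vec (1 # ys) \<in> lattice (p # D)" if "length ys = n + 1" for ys
    using that lattice_units[of "n + 2"] unfolding U by (simp add: vec_def)
  then have "desc_set C = {ys. length ys = n + 1 \<and> (\<forall>\<alpha> \<in> fst ` (set fs \<union> set gs).
      inner (row q \<alpha> (lookup_terms \<alpha> fs) (lookup_terms \<alpha> gs)) (vec (1 # ys)) = 0)}"
    unfolding C(3) G(3) F(3) by blast
  ultimately show ?thesis using C(2) by blast
qed

text \<open>If \<open>c / d\<close> is a power of \<open>q\<close>, exponents can be compared by
  injectivity. Otherwise both sides fail; for \<open>c = d = 0\<close> the right side would hold,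
  which the first assumption excludes.\<close>

lemma inner_row_eq_0_iff:
  assumes "c \<noteq> 0 \<or> d \<noteq> 0" "length \<alpha> = length ls"
  shows "inner (row q \<alpha> c d) (vec (1 # l # ls)) = 0 \<longleftrightarrow>
    c = q powi (l + (\<Sum>i<length ls. ls ! i * int (\<alpha> ! i))) * d"
proof -
  let ?s = "\<Sum>i<length ls. ls ! i * int (\<alpha> ! i)"
  have s: "inner (map int \<alpha>) (vec ls) = ?s"
    unfolding inner_def using assms(2) by (intro sum.cong) (auto simp: vec_def)
  show ?thesis
  proof (cases "d \<noteq> 0 \<and> (\<exists>k::int. c / d = q powi k)")
    case True
    then obtain k where k: "d \<noteq> 0" "c / d = q powi k" by blast
    then have "(THE k'. c / d = q powi k') = k"
      using powi_eq_iff by auto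
    then have "row q \<alpha> c d = - k # 1 # map int \<alpha>"
      using True by (simp add: row_def)
    then have "inner (row q \<alpha> c d) (vec (1 # l # ls)) = 0 \<longleftrightarrow> k = l + ?s"
      by (simp add: s) linarith
    also have "\<dots> \<longleftrightarrow> c / d = q powi (l + ?s)"
      unfolding k(2) by (simp add: powi_eq_iff)
    finally show ?thesis using k(1) by (simp add: field_simps)
  next
    case False
    then have "c \<noteq> q powi k * d" for k
      using assms(1) by (cases "d = 0") (auto simp: field_simps)
    with False show ?thesis by (auto simp: row_def)
  qed
qed

text \<open>Off both supports the coefficient identity reads 0 = 0, which leaves the finitely many
  listed monomials.\<close>

lemma mem_qDisp_iff_rows:
  assumes f: "f \<in> polys n" "term_list n f fs" and g: "g \<in> polys n" "term_list n g gs"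
    and ys: "length ys = n + 1"
  shows "ys \<in> qDisp n q f g \<longleftrightarrow> (\<forall>\<alpha> \<in> fst ` (set fs \<union> set gs).
      inner (row q \<alpha> (lookup_terms \<alpha> fs) (lookup_terms \<alpha> gs)) (vec (1 # ys)) = 0)"
proof -
  obtain l ls where l: "ys = l # ls" "length ls = n"
    using ys by (cases ys) auto
  let ?K = "Poly_Mapping.keys f \<union> Poly_Mapping.keys g"
  let ?v = "\<lambda>m. map (Poly_Mapping.lookup m) [0..<n]"
  let ?s = "\<lambda>m. \<Sum>i<n. ls ! i * int (Poly_Mapping.lookup m i)"
  have "inner (row q (?v m) (lookup_terms (?v m) fs) (lookup_terms (?v m) gs)) (vec (1 # ys)) = 0 \<longleftrightarrow>
      Poly_Mapping.lookup f m = q powi (l + ?s m) * Poly_Mapping.lookup g m" if "m \<in> ?K" for m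
  proof -
    have m: "Poly_Mapping.keys m \<subseteq> {..<n}"
      using that f(1) g(1) by (auto simp: polys_def)
    have "Poly_Mapping.lookup f m \<noteq> 0 \<or> Poly_Mapping.lookup g m \<noteq> 0"
      using that by (simp add: in_keys_iff)
    then show ?thesis
      unfolding lookup_terms_eq[OF f m] lookup_terms_eq[OF g m] l(1)
      by (subst inner_row_eq_0_iff) (simp_all add: l(2))
  qed
  moreover have "fst ` (set fs \<union> set gs) = ?v ` ?K"
    using f(2) g(2) by (simp add: term_list_def image_Un image_image)
  moreover have "Poly_Mapping.lookup f m = q powi (l + ?s m) * Poly_Mapping.lookup g m" if "m \<notin> ?K" for m
    using that by (simp add: in_keys_iff)
  then have "ys \<in> qDisp n q f g \<longleftrightarrow>
      (\<forall>m \<in> ?K. Poly_Mapping.lookup f m = q powi (l + ?s m) * Poly_Mapping.lookup g m)"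
    unfolding l(1) mem_qDisp_iff[OF q_nonzero l(2)] by blast
  ultimately show ?thesis by simp
qed

lemma computes_qDisp_Solve: "computes_qDisp q Solve"
  unfolding computes_qDisp_def
proof (intro allI ballI impI)
  fix n and f g :: "'a mpoly" and fs gs :: "(nat list \<times> 'a) list"
  assume fg: "f \<in> polys n" "g \<in> polys n" "term_list n f fs" "term_list n g gs"
  have "length \<beta> = n" if "\<beta> \<in> fst ` set fs \<or> \<beta> \<in> fst ` set gs" for \<beta>
    using that fg(3,4) by (auto simp: term_list_def)
  then obtain C where C: "sem q Solve (enc_input n fs gs) = Some (enc_desc C)" "wf_desc (n + 1) C"
    "desc_set C = {ys. length ys = n + 1 \<and> (\<forall>\<alpha> \<in> fst ` (set fs \<union> set gs).
      inner (row q \<alpha> (lookup_terms \<alpha> fs) (lookup_terms \<alpha> gs)) (vec (1 # ys)) = 0)}"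
    using sem_Solve[of fs n gs] by blast
  have "length ys = n + 1" if "ys \<in> qDisp n q f g" for ys
    using that by (auto simp: qDisp_def)
  then have "desc_set C = qDisp n q f g"
    unfolding C(3) using mem_qDisp_iff_rows[OF fg(1,3) fg(2,4)] by blast
  with C(1,2) show "\<exists>D. run q Solve (enc_input n fs gs) (enc_desc D) \<and> wf_desc (n + 1) D \<and>
      desc_set D = qDisp n q f g"
    by (auto simp: sem_eq_Some_iff)
qed

end

section \<open>Deciding equivalence by a test for emptiness\<close>

lemma q_shift_equivalent_iff: "q_shift_equivalent n q f g \<longleftrightarrow> qDisp n q f g \<noteq> {}"
  by (auto simp: q_shift_equivalent_def qDisp_def)

text \<open>A described coset is never empty and is encoded as a pair, while the empty set is
  \<open>VNull\<close>, so the shape of the output decides.\<close>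

lemma decides_if_computes:
  fixes q :: "'a::field"
  assumes "computes_qDisp q P"
  shows "decides_q_shift_equivalence q (Seq P (Prim IsPair))"
  unfolding decides_q_shift_equivalence_def
proof (intro allI ballI impI)
  fix n and f g :: "'a mpoly" and fs gs :: "(nat list \<times> 'a) list"
  assume "f \<in> polys n" "g \<in> polys n" "term_list n f fs" "term_list n g gs"
  then obtain C where C: "run q P (enc_input n fs gs) (enc_desc C)" "desc_set C = qDisp n q f g"
    using assms unfolding computes_qDisp_def by blast
  have "apply_prim q IsPair (enc_desc C) = Some (VBool (desc_set C \<noteq> {}))"
    by (cases C rule: desc_set.cases) auto
  then show "run q (Seq P (Prim IsPair)) (enc_input n fs gs) (VBool (q_shift_equivalent n q f g))"
    unfolding C(2) q_shift_equivalent_iff by (rule run_Seq[OF C(1) run_Prim])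
qed

theorem theorem2p2:
  fixes q :: "'a::field_char_0"
  assumes "q \<noteq> 0"
    and "\<And>k::nat. k > 0 \<Longrightarrow> q ^ k \<noteq> 1"
  shows "(\<exists>P. computes_qDisp q P) \<and>
         (\<exists>P. decides_q_shift_equivalence q P) \<and>
         (\<forall>n. \<forall>f \<in> polys n. \<forall>g \<in> polys n.
            q_shift_equivalent n q f g \<longleftrightarrow> qDisp n q f g \<noteq> {})"
proof -
  interpret non_root_of_unity q
    by unfold_locales (use assms in auto)
  show ?thesis
    using computes_qDisp_Solve decides_if_computes q_shift_equivalent_iff by blast
qed

end
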